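(* For all $L$-formulas $\alpha,\beta$: $\alpha\vdash\beta$ is valid in all involutive linearly ordered Routley IFs iff $\alpha\vdash\beta\in\mathsf{KL}$. Moreover, $\mathsf{KL}$ is exactly the set of $L$-pairs valid in the Routley IF $\mathcal{I}(\mathsf{KL})$.
   Context: Let $L$ be the set of formulas built from a set $At$ of atomic formulas with $\wedge,\vee,\neg$; an $L$-pair is written $\alpha\vdash\beta$. $\mathsf{KL}$ (Kalman logic) is the set of $L$-pairs derivable in the system with, for all formulas $\alpha,\beta,\gamma$, the axioms $\alpha\vdash\alpha$; $\alpha\wedge\beta\vdash\alpha$; $\alpha\wedge\beta\vdash\beta$; $\alpha\vdash\alpha\vee\beta$; $\beta\vdash\alpha\vee\beta$; $\alpha\wedge(\beta\vee\gamma)\vdash(\alpha\wedge\beta)\vee(\alpha\wedge\gamma)$; $\neg(\alpha\wedge\beta)\vdash\neg\alpha\vee\neg\beta$; $\neg\alpha\wedge\neg\beta\vdash\neg(\alpha\vee\beta)$; $\alpha\vdash\neg\neg\alpha$; $\neg\neg\alpha\vdash\alpha$; $\alpha\wedge\neg\alpha\vdash\beta\vee\neg\beta$; and the rules: from $\alpha\vdash\beta$ and $\beta\vdash\gamma$ infer $\alpha\vdash\gamma$; from $\alpha\vdash\beta$ and $\alpha\vdash\gamma$ infer $\alpha\vdash\beta\wedge\gamma$; from $\alpha\vdash\gamma$ and $\beta\vdash\gamma$ infer $\alpha\vee\beta\vdash\gamma$; from $\alpha\vdash\beta$ infer $\neg\beta\vdash\neg\alpha$. A Routley IF is a structure $\langle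 S,\circ,*,i,e\rangle$ where $S$ is a nonempty set, $\circ$ is an associative, commutative, idempotent binary operation on $S$, $*:S\to S$, and $i\neq e$ are elements of $S$ such that: $s\circ i=s$ and $s\circ e=e$ for all $s$; if $e=t\circ u$ then $e=t$ or $e=u$; and, writing $s\le t$ iff $s\circ t=s$: $i^*=e$ and $e^*=i$; $t\le u$ implies $u^*\le t^*$; for all $t,u$, $(t\circ u)^*\le t^*$ or $(t\circ u)^*\le u^*$. It is linearly ordered if $\le$ is a linear order, and involutive if $s^{**}=s$ for all $s$. $\mathcal{I}(\mathsf{KL})$ is the four-element linearly ordered Routley IF with states $e<t<s<i$ (with $\circ$ the meet of this chain) and $i^*=e$, $e^*=i$, $s^*=t$, $t^*=s$. A proper filter is $F\subseteq S$ with $i\in F$, $e\notin F$, and $t\circ u\in F$ iff $t\in F$ and $u\in F$. A Routley IM is a Routley IF with a valuation $V$ assigning a proper filter to each atom. Support: $s\Vdash p$ iff $s\in V(p)$; $s\Vdash\alpha\wedge\beta$ iff $s\Vdash\alpha$ and $s\Vdash\beta$; $s\Vdash\alpha\vee\beta$ iff there are $t,u$ with $t\Vdash\alpha$, $u\Vdash\beta$, $t\circ u\le s$; $s\Vdash\neg\alpha$ iff $s^*\nVdash\alpha$. $\alpha\vdash\beta$ is valid in a Routley IF if in every Routley IM based on it every state supporting $\alpha$ supports $\beta$; valid in a class if valid in every member. *)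

theory Defs
  imports Main
begin

datatype 'a fm =
    Atom 'a
  | Conj "'a fm" "'a fm" (infixr "\<^bold>\<and>" 70)
  | Disj "'a fm" "'a fm" (infixr "\<^bold>\<or>" 65)
  | Neg "'a fm" ("\<^bold>\<not> _" [75] 75)

abbreviation lpair :: "'a fm \<Rightarrow> 'a fm \<Rightarrow> 'a fm \<times> 'a fm" (infix "\<turnstile>" 60) where
  "\<alpha> \<turnstile> \<beta> \<equiv> (\<alpha>, \<beta>)"

inductive_set KL :: "('a fm \<times> 'a fm) set" where
  refl: "\<alpha> \<turnstile> \<alpha> \<in> KL"
| conjE1: "\<alpha> \<^bold>\<and> \<beta> \<turnstile> \<alpha> \<in> KL"
| conjE2: "\<alpha> \<^bold>\<and> \<beta> \<turnstile> \<beta> \<in> KL"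
| disjI1: "\<alpha> \<turnstile> \<alpha> \<^bold>\<or> \<beta> \<in> KL"
| disjI2: "\<beta> \<turnstile> \<alpha> \<^bold>\<or> \<beta> \<in> KL"
| distrib: "\<alpha> \<^bold>\<and> (\<beta> \<^bold>\<or> \<gamma>) \<turnstile> (\<alpha> \<^bold>\<and> \<beta>) \<^bold>\<or> (\<alpha> \<^bold>\<and> \<gamma>) \<in> KL"
| neg_conj: "\<^bold>\<not> (\<alpha> \<^bold>\<and> \<beta>) \<turnstile> \<^bold>\<not> \<alpha> \<^bold>\<or> \<^bold>\<not> \<beta> \<in> KL"
| neg_disj: "\<^bold>\<not> \<alpha> \<^bold>\<and> \<^bold>\<not> \<beta> \<turnstile> \<^bold>\<not> (\<alpha> \<^bold>\<or> \<beta>) \<in> KL"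
| dnegI: "\<alpha> \<turnstile> \<^bold>\<not> \<^bold>\<not> \<alpha> \<in> KL"
| dnegE: "\<^bold>\<not> \<^bold>\<not> \<alpha> \<turnstile> \<alpha> \<in> KL"
| kalman: "\<alpha> \<^bold>\<and> \<^bold>\<not> \<alpha> \<turnstile> \<beta> \<^bold>\<or> \<^bold>\<not> \<beta> \<in> KL"
| trans: "\<alpha> \<turnstile> \<beta> \<in> KL \<Longrightarrow> \<beta> \<turnstile> \<gamma> \<in> KL \<Longrightarrow> \<alpha> \<turnstile> \<gamma> \<in> KL"
| conjI: "\<alpha> \<turnstile> \<beta> \<in> KL \<Longrightarrow> \<alpha> \<turnstile> \<gamma> \<in> KL \<Longrightarrow> \<alpha> \<turnstile> \<beta> \<^bold>\<and> \<gamma> \<in> KL"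
| disjE: "\<alpha> \<turnstile> \<gamma> \<in> KL \<Longrightarrow> \<beta> \<turnstile> \<gamma> \<in> KL \<Longrightarrow> \<alpha> \<^bold>\<or> \<beta> \<turnstile> \<gamma> \<in> KL"
| contrapos: "\<alpha> \<turnstile> \<beta> \<in> KL \<Longrightarrow> \<^bold>\<not> \<beta> \<turnstile> \<^bold>\<not> \<alpha> \<in> KL"

record 's routley =
  states :: "'s set"
  comp :: "'s \<Rightarrow> 's \<Rightarrow> 's"
  star :: "'s \<Rightarrow> 's"
  istate :: 's
  estate :: 's

definition le :: "'s routley \<Rightarrow> 's \<Rightarrow> 's \<Rightarrow> bool" where
  "le F s t \<longleftrightarrow> comp F s t = s"

text \<open>The operations are only constrained on the carrier; their values elsewhere are irrelevant.\<close>

definition routley_IF :: "'s routley \<Rightarrow> bool" where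
  "routley_IF F \<longleftrightarrow>
     (\<forall>s\<in>states F. \<forall>t\<in>states F. comp F s t \<in> states F) \<and>
     (\<forall>s\<in>states F. star F s \<in> states F) \<and>
     istate F \<in> states F \<and> estate F \<in> states F \<and> istate F \<noteq> estate F \<and>
     (\<forall>s\<in>states F. \<forall>t\<in>states F. \<forall>u\<in>states F.
        comp F (comp F s t) u = comp F s (comp F t u)) \<and>
     (\<forall>s\<in>states F. \<forall>t\<in>states F. comp F s t = comp F t s) \<and>
     (\<forall>s\<in>states F. comp F s s = s) \<and>
     (\<forall>s\<in>states F. comp F s (istate F) = s) \<and>
     (\<forall>s\<in>states F. comp F s (estate F) = estate F) \<and>
     (\<forall>t\<in>states F. \<forall>u\<in>states F.
        estate F = comp F t u \<longrightarrow> estate F = t \<or> estate F = u) \<and>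
     star F (istate F) = estate F \<and> star F (estate F) = istate F \<and>
     (\<forall>t\<in>states F. \<forall>u\<in>states F. le F t u \<longrightarrow> le F (star F u) (star F t)) \<and>
     (\<forall>t\<in>states F. \<forall>u\<in>states F.
        le F (star F (comp F t u)) (star F t) \<or> le F (star F (comp F t u)) (star F u))"

definition linearly_ordered :: "'s routley \<Rightarrow> bool" where
  "linearly_ordered F \<longleftrightarrow>
     linear_order_on (states F) {(s, t). s \<in> states F \<and> t \<in> states F \<and> le F s t}"

definition involutive :: "'s routley \<Rightarrow> bool" where
  "involutive F \<longleftrightarrow> (\<forall>s\<in>states F. star F (star F s) = s)"

definition proper_filter :: "'s routley \<Rightarrow> 's set \<Rightarrow> bool" where
  "proper_filter F A \<longleftrightarrow>
     A \<subseteq> states F \<and> istate F \<in> A \<and> estate F \<notin> A \<and>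
     (\<forall>t\<in>states F. \<forall>u\<in>states F. comp F t u \<in> A \<longleftrightarrow> t \<in> A \<and> u \<in> A)"

definition routley_IM :: "'s routley \<Rightarrow> ('a \<Rightarrow> 's set) \<Rightarrow> bool" where
  "routley_IM F V \<longleftrightarrow> routley_IF F \<and> (\<forall>p. proper_filter F (V p))"

primrec supports :: "'s routley \<Rightarrow> ('a \<Rightarrow> 's set) \<Rightarrow> 's \<Rightarrow> 'a fm \<Rightarrow> bool" where
  "supports F V s (Atom p) \<longleftrightarrow> s \<in> V p"
| "supports F V s (\<alpha> \<^bold>\<and> \<beta>) \<longleftrightarrow> supports F V s \<alpha> \<and> supports F V s \<beta>"
| "supports F V s (\<alpha> \<^bold>\<or> \<beta>) \<longleftrightarrow>
     (\<exists>t\<in>states F. \<exists>u\<in>states F. supports F V t \<alpha> \<and> supports F V u \<beta> \<and> le F (comp F t u) s)"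
| "supports F V s (\<^bold>\<not> \<alpha>) \<longleftrightarrow> \<not> supports F V (star F s) \<alpha>"

definition valid :: "'s routley \<Rightarrow> 'a fm \<Rightarrow> 'a fm \<Rightarrow> bool" where
  "valid F \<alpha> \<beta> \<longleftrightarrow>
     (\<forall>V. routley_IM F V \<longrightarrow> (\<forall>s\<in>states F. supports F V s \<alpha> \<longrightarrow> supports F V s \<beta>))"

definition valid_in_class :: "'s routley set \<Rightarrow> 'a fm \<Rightarrow> 'a fm \<Rightarrow> bool" where
  "valid_in_class K \<alpha> \<beta> \<longleftrightarrow> (\<forall>F\<in>K. valid F \<alpha> \<beta>)"

text \<open>The class consists of the frames carried by arbitrary (possibly finite) subsets of the state type,
  so an infinite state type is one large enough to contain a copy of every finite frame.\<close>

definition inv_lin_IFs :: "'s routley set" where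
  "inv_lin_IFs = {F. routley_IF F \<and> involutive F \<and> linearly_ordered F}"

datatype state4 = St_e | St_t | St_s | St_i

primrec rank4 :: "state4 \<Rightarrow> nat" where
  "rank4 St_e = 0"
| "rank4 St_t = 1"
| "rank4 St_s = 2"
| "rank4 St_i = 3"

primrec star4 :: "state4 \<Rightarrow> state4" where
  "star4 St_e = St_i"
| "star4 St_t = St_s"
| "star4 St_s = St_t"
| "star4 St_i = St_e"

definition I_KL :: "state4 routley" where
  "I_KL = \<lparr>states = UNIV, comp = (\<lambda>x y. if rank4 x \<le> rank4 y then x else y),
           star = star4, istate = St_i, estate = St_e\<rparr>"

lemma le_I_KL: "le I_KL x y \<longleftrightarrow> rank4 x \<le> rank4 y"
  by (cases x; cases y) (simp_all add: le_def I_KL_def)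

lemma I_KL_in_inv_lin_IFs: "I_KL \<in> inv_lin_IFs"
proof -
  have all4: "(\<forall>x. P x) \<longleftrightarrow> P St_e \<and> P St_t \<and> P St_s \<and> P St_i" for P
    by (metis state4.exhaust)
  have "routley_IF I_KL"
    unfolding routley_IF_def le_I_KL by (simp add: I_KL_def all4)
  moreover have "involutive I_KL"
    unfolding involutive_def by (simp add: I_KL_def all4)
  moreover have "linearly_ordered I_KL"
    unfolding linearly_ordered_def le_I_KL linear_order_on_def partial_order_on_def
      preorder_on_def refl_on_def trans_def antisym_def total_on_def
    by (simp add: I_KL_def all4)
  ultimately show ?thesis
    by (simp add: inv_lin_IFs_def)
qed

end

theory Submission
  imports Defs
begin

text \<open>In a linearly ordered frame disjunction is classical, and an involutive star then makes all
  axioms sound; linearity enters the Kalman axiom by comparing \<open>s\<close> with \<open>s*\<close>. Conversely, if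
  \<open>\<alpha> \<turnstile> \<beta>\<close> is not derivable, Zorn's lemma yields a prime theory \<open>T\<close> containing \<open>\<alpha>\<close> but not \<open>\<beta>\<close>.
  By the Kalman axiom, \<open>T\<close> and its dual \<open>T* = {\<gamma>. \<not>\<gamma> \<notin> T}\<close> are comparable under inclusion, so they
  can serve as the theories of the two middle states of the four-element chain. Copying this chain
  along an injection into the given infinite type refutes the pair there as well.\<close>

section \<open>Soundness\<close>

locale routley_model =
  fixes F :: "'s routley" and V :: "'a \<Rightarrow> 's set"
  assumes model: "routley_IM F V"
begin

lemma frame: "routley_IF F"
  using model by (simp add: routley_IM_def)

lemma filter: "proper_filter F (V p)"
  using model by (simp add: routley_IM_def)

lemma comp_closed: "\<lbrakk>s \<in> states F; t \<in> states F\<rbrakk> \<Longrightarrow> comp F s t \<in> states F"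
  and star_closed: "s \<in> states F \<Longrightarrow> star F s \<in> states F"
  and istate_closed: "istate F \<in> states F"
  and estate_closed: "estate F \<in> states F"
  and comp_commute: "\<lbrakk>s \<in> states F; t \<in> states F\<rbrakk> \<Longrightarrow> comp F s t = comp F t s"
  and comp_assoc: "\<lbrakk>s \<in> states F; t \<in> states F; u \<in> states F\<rbrakk> \<Longrightarrow>
      comp F (comp F s t) u = comp F s (comp F t u)"
  and comp_idem: "s \<in> states F \<Longrightarrow> comp F s s = s"
  and comp_istate: "s \<in> states F \<Longrightarrow> comp F s (istate F) = s"
  and comp_estate: "s \<in> states F \<Longrightarrow> comp F s (estate F) = estate F"
  and estate_prime: "\<lbrakk>t \<in> states F; u \<in> states F; estate F = comp F t u\<rbrakk> \<Longrightarrow>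
      estate F = t \<or> estate F = u"
  and star_istate: "star F (istate F) = estate F"
  and star_estate: "star F (estate F) = istate F"
  and star_antimono: "\<lbrakk>t \<in> states F; u \<in> states F; le F t u\<rbrakk> \<Longrightarrow> le F (star F u) (star F t)"
  using frame unfolding routley_IF_def by blast+

lemma le_trans:
  "\<lbrakk>le F s t; le F t u; s \<in> states F; t \<in> states F; u \<in> states F\<rbrakk> \<Longrightarrow> le F s u"
  unfolding le_def by (metis comp_assoc)

text \<open>Atoms persist because filters are upward closed. At a negation the antitone star turns
  \<open>le F s t\<close> into \<open>le F (star F t) (star F s)\<close>, so the induction must
  leave both states arbitrary.\<close>

lemma supports_mono:
  "\<lbrakk>supports F V s \<alpha>; le F s t; s \<in> states F; t \<in> states F\<rbrakk> \<Longrightarrow> supports F V t \<alpha>"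
proof (induction \<alpha> arbitrary: s t)
  case (Atom p)
  then show ?case
    using filter[of p] by (simp add: le_def proper_filter_def) metis
next
  case (Conj \<alpha> \<beta>)
  then show ?case by auto
next
  case (Disj \<alpha> \<beta>)
  then show ?case by simp (metis comp_closed le_trans)
next
  case (Neg \<alpha>)
  then show ?case by simp (metis star_antimono star_closed)
qed

text \<open>Both halves need one joint induction, because the star exchanges \<open>istate F\<close>
  and \<open>estate F\<close> at a negation. The first half later lets \<open>istate F\<close>
  witness a disjunct about which nothing is known.\<close>

lemma supports_istate_estate: "supports F V (istate F) \<alpha> \<and> \<not> supports F V (estate F) \<alpha>"
proof (induction \<alpha>)
  case (Atom p)
  then show ?case using filter[of p] by (simp add: proper_filter_def)
next
  case (Conj \<alpha> \<beta>)
  then show ?case by simp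
next
  case (Disj \<alpha> \<beta>)
  have "le F (comp F (istate F) (istate F)) (istate F)"
    by (simp add: le_def comp_istate istate_closed)
  \<comment> \<open>Lying below \<open>estate F\<close> forces \<open>comp F t u = estate F\<close>.
    Primeness of \<open>estate F\<close> then makes one component equal to it, and that component
    supports neither disjunct.\<close>
  moreover have "t = estate F \<or> u = estate F"
    if "t \<in> states F" "u \<in> states F" "le F (comp F t u) (estate F)" for t u
    using that comp_closed comp_estate estate_prime unfolding le_def by metis
  ultimately show ?case
    using Disj istate_closed by auto
next
  case (Neg \<alpha>)
  then show ?case by (simp add: star_istate star_estate)
qed

end

section \<open>Linear involutive models\<close>

locale linear_involutive_model = routley_model +
  assumes linear: "linearly_ordered F" and involutive: "involutive F"
begin

lemma le_total: "\<lbrakk>s \<in> states F; t \<in> states F\<rbrakk> \<Longrightarrow> le F s t \<or> le F t s"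
  using linear comp_idem
  unfolding linearly_ordered_def linear_order_on_def total_on_def le_def
  by (cases "s = t") auto

lemma star_star: "s \<in> states F \<Longrightarrow> star F (star F s) = s"
  using involutive by (simp add: involutive_def)

text \<open>Linearity makes \<open>comp F t u\<close> one of \<open>t\<close> and \<open>u\<close>,
  so persistence carries a disjunct up to \<open>s\<close>. Conversely, \<open>s\<close> is paired
  with \<open>istate F\<close>, which supports every formula and leaves \<open>s\<close> unchanged
  under composition.\<close>

lemma supports_disj:
  assumes s: "s \<in> states F"
  shows "supports F V s (\<alpha> \<^bold>\<or> \<beta>) \<longleftrightarrow> supports F V s \<alpha> \<or> supports F V s \<beta>"
proof
  assume "supports F V s (\<alpha> \<^bold>\<or> \<beta>)"
  then obtain t u where tu: "t \<in> states F" "u \<in> states F" "supports F V t \<alpha>" "supports F V u \<beta>"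
      "le F (comp F t u) s"
    by auto
  then have "comp F t u = t \<or> comp F t u = u"
    using le_total comp_commute unfolding le_def by metis
  then show "supports F V s \<alpha> \<or> supports F V s \<beta>"
    using tu s supports_mono by metis
next
  have "comp F s (istate F) = s" "comp F (istate F) s = s" "le F s s"
    using s comp_istate comp_commute comp_idem istate_closed by (auto simp: le_def)
  moreover assume "supports F V s \<alpha> \<or> supports F V s \<beta>"
  ultimately show "supports F V s (\<alpha> \<^bold>\<or> \<beta>)"
    using s istate_closed supports_istate_estate by simp metis
qed

text \<open>Since \<open>s\<close> supports \<alpha> and \<open>star F s\<close> does not,
  persistence rules out \<open>le F s (star F s)\<close>, and linearity gives
  \<open>le F (star F s) s\<close>. If \<open>s\<close> does not support the negation of \<beta>,
  then \<open>star F s\<close> supports \<beta>, hence so does \<open>s\<close>.\<close>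

lemma supports_kalman:
  assumes s: "s \<in> states F" and "supports F V s (\<alpha> \<^bold>\<and> \<^bold>\<not> \<alpha>)"
  shows "supports F V s (\<beta> \<^bold>\<or> \<^bold>\<not> \<beta>)"
proof -
  have "\<not> le F s (star F s)"
    using assms supports_mono star_closed by (simp, blast)
  then have "le F (star F s) s"
    using le_total s star_closed by blast
  then show ?thesis
    using s star_closed supports_mono supports_disj by (simp del: supports.simps(3)) blast
qed

lemma KL_supports:
  "\<lbrakk>\<alpha> \<turnstile> \<beta> \<in> KL; s \<in> states F; supports F V s \<alpha>\<rbrakk> \<Longrightarrow> supports F V s \<beta>"
proof (induction \<alpha> \<beta> arbitrary: s rule: KL.induct)
  case (kalman \<alpha> \<beta>)
  then show ?case using supports_kalman by blast
qed (auto simp: supports_disj star_closed star_star simp del: supports.simps(3))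

end

lemma KL_sound:
  assumes "\<alpha> \<turnstile> \<beta> \<in> KL"
  shows "valid_in_class inv_lin_IFs \<alpha> \<beta>"
  unfolding valid_in_class_def valid_def
proof (intro ballI allI impI)
  fix F :: "'s routley" and V s
  assume "F \<in> inv_lin_IFs" and "routley_IM F V" and "s \<in> states F" "supports F V s \<alpha>"
  then interpret linear_involutive_model F V
    by unfold_locales (simp_all add: inv_lin_IFs_def)
  show "supports F V s \<beta>"
    using assms \<open>s \<in> states F\<close> \<open>supports F V s \<alpha>\<close> by (rule KL_supports)
qed

section \<open>Prime theories\<close>

text \<open>Up to provable equivalence these are the filters of the Lindenbaum lattice, together
  with the empty set.\<close>

definition theory_KL :: "'a fm set \<Rightarrow> bool" where
  "theory_KL T \<longleftrightarrow> (\<forall>\<gamma>\<in>T. \<forall>\<delta>. \<gamma> \<turnstile> \<delta> \<in> KL \<longrightarrow> \<delta> \<in> T) \<and> (\<forall>\<gamma>\<in>T. \<forall>\<delta>\<in>T. \<gamma> \<^bold>\<and> \<delta> \<in> T)"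

definition prime_theory :: "'a fm set \<Rightarrow> bool" where
  "prime_theory T \<longleftrightarrow> theory_KL T \<and> (\<forall>\<gamma> \<delta>. \<gamma> \<^bold>\<or> \<delta> \<in> T \<longrightarrow> \<gamma> \<in> T \<or> \<delta> \<in> T)"

lemma theory_KL_closed: "\<lbrakk>theory_KL T; \<gamma> \<in> T; \<gamma> \<turnstile> \<delta> \<in> KL\<rbrakk> \<Longrightarrow> \<delta> \<in> T"
  by (auto simp: theory_KL_def)

lemma theory_KL_conj: "theory_KL T \<Longrightarrow> \<gamma> \<^bold>\<and> \<delta> \<in> T \<longleftrightarrow> \<gamma> \<in> T \<and> \<delta> \<in> T"
  unfolding theory_KL_def using KL.conjE1 KL.conjE2 by blast

section \<open>Extension to prime theories\<close>

lemma KL_conj_mono: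
  "\<lbrakk>\<alpha> \<turnstile> \<gamma> \<in> KL; \<beta> \<turnstile> \<delta> \<in> KL\<rbrakk> \<Longrightarrow> \<alpha> \<^bold>\<and> \<beta> \<turnstile> \<gamma> \<^bold>\<and> \<delta> \<in> KL"
  by (intro KL.conjI KL.trans[OF KL.conjE1] KL.trans[OF KL.conjE2])

text \<open>For nonempty \<open>T\<close> this set is the theory generated by \<open>T\<close> and
  \<gamma>. Two witnesses from \<open>T\<close> merge into their conjunction, which stays in
  \<open>T\<close>.\<close>

lemma theory_KL_adjoin:
  assumes "theory_KL T"
  shows "theory_KL {\<delta>. \<exists>\<tau>\<in>T. \<tau> \<^bold>\<and> \<gamma> \<turnstile> \<delta> \<in> KL}" (is "theory_KL ?S")
  unfolding theory_KL_def
proof (intro HOL.conjI ballI allI impI)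
  fix \<delta> \<epsilon>
  assume "\<delta> \<in> ?S" "\<delta> \<turnstile> \<epsilon> \<in> KL"
  then show "\<epsilon> \<in> ?S" using KL.trans by blast
next
  fix \<delta> \<epsilon>
  assume "\<delta> \<in> ?S" "\<epsilon> \<in> ?S"
  then obtain \<sigma> \<tau> where "\<sigma> \<in> T" "\<tau> \<in> T" and 1: "\<sigma> \<^bold>\<and> \<gamma> \<turnstile> \<delta> \<in> KL" and 2: "\<tau> \<^bold>\<and> \<gamma> \<turnstile> \<epsilon> \<in> KL"
    by blast
  then have "\<sigma> \<^bold>\<and> \<tau> \<in> T" using assms by (simp add: theory_KL_conj)
  moreover have "(\<sigma> \<^bold>\<and> \<tau>) \<^bold>\<and> \<gamma> \<turnstile> \<delta> \<^bold>\<and> \<epsilon> \<in> KL"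
    by (intro KL.conjI KL.trans[OF KL_conj_mono[OF KL.conjE1 KL.refl] 1]
        KL.trans[OF KL_conj_mono[OF KL.conjE2 KL.refl] 2])
  ultimately show "\<delta> \<^bold>\<and> \<epsilon> \<in> ?S" by blast
qed

text \<open>If \<gamma> and \<delta> were both outside \<open>T\<close>, maximality would make
  \<beta> derivable after adjoining either one. Distributivity combines the two derivations into one
  from their disjunction, forcing \<beta> into \<open>T\<close>.\<close>

lemma maximal_theory_prime:
  assumes T: "theory_KL T" and \<beta>: "\<beta> \<notin> T" and "T \<noteq> {}"
    and max: "\<And>S. \<lbrakk>theory_KL S; \<beta> \<notin> S; T \<subseteq> S\<rbrakk> \<Longrightarrow> S = T"
  shows "prime_theory T"
proof -
  have adjoin: "\<exists>\<tau>\<in>T. \<tau> \<^bold>\<and> \<gamma> \<turnstile> \<beta> \<in> KL" if "\<gamma> \<notin> T" for \<gamma>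
  proof (rule ccontr)
    let ?S = "{\<delta>. \<exists>\<tau>\<in>T. \<tau> \<^bold>\<and> \<gamma> \<turnstile> \<delta> \<in> KL}"
    assume "\<not> (\<exists>\<tau>\<in>T. \<tau> \<^bold>\<and> \<gamma> \<turnstile> \<beta> \<in> KL)"
    then have "?S = T"
      by (intro max theory_KL_adjoin[OF T]) (use KL.conjE1 in auto)
    \<comment> \<open>Nonemptiness supplies some \<tau> in \<open>T\<close> whose conjunction with
      \<gamma> derives \<gamma>.\<close>
    moreover have "\<gamma> \<in> ?S"
      using \<open>T \<noteq> {}\<close> KL.conjE2 by blast
    ultimately show False using that by blast
  qed
  have "\<gamma> \<in> T \<or> \<delta> \<in> T" if disj: "\<gamma> \<^bold>\<or> \<delta> \<in> T" for \<gamma> \<delta>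
  proof (rule ccontr)
    assume "\<not> (\<gamma> \<in> T \<or> \<delta> \<in> T)"
    then obtain \<sigma> \<tau> where st: "\<sigma> \<in> T" "\<tau> \<in> T" and 1: "\<sigma> \<^bold>\<and> \<gamma> \<turnstile> \<beta> \<in> KL" and 2: "\<tau> \<^bold>\<and> \<delta> \<turnstile> \<beta> \<in> KL"
      using adjoin by blast
    \<comment> \<open>A common premise from \<open>T\<close> for both derivations, so that
      \<open>KL.distrib\<close> can join them.\<close>
    let ?\<rho> = "\<sigma> \<^bold>\<and> \<tau>"
    have "?\<rho> \<^bold>\<and> \<gamma> \<turnstile> \<beta> \<in> KL" "?\<rho> \<^bold>\<and> \<delta> \<turnstile> \<beta> \<in> KL"
      using KL.trans[OF KL_conj_mono[OF KL.conjE1 KL.refl] 1]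
        KL.trans[OF KL_conj_mono[OF KL.conjE2 KL.refl] 2] by blast+
    then have "?\<rho> \<^bold>\<and> (\<gamma> \<^bold>\<or> \<delta>) \<turnstile> \<beta> \<in> KL"
      by (rule KL.trans[OF KL.distrib KL.disjE])
    moreover have "?\<rho> \<^bold>\<and> (\<gamma> \<^bold>\<or> \<delta>) \<in> T"
      using T st disj by (simp add: theory_KL_conj)
    ultimately show False using T \<beta> theory_KL_closed by blast
  qed
  then show ?thesis using T by (simp add: prime_theory_def)
qed

text \<open>Zorn's lemma is applied to the theories containing \<alpha> and omitting \<beta>.
  Underivability puts the principal theory of \<alpha> into this family.\<close>

lemma prime_theory_exists:
  assumes "\<alpha> \<turnstile> \<beta> \<notin> KL"
  obtains T where "prime_theory T" "\<alpha> \<in> T" "\<beta> \<notin> T"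
proof -
  let ?A = "{T. theory_KL T \<and> \<alpha> \<in> T \<and> \<beta> \<notin> T}"
  have "theory_KL {\<gamma>. \<alpha> \<turnstile> \<gamma> \<in> KL}"
    by (simp add: theory_KL_def KL.conjI) (meson KL.trans)
  then have "{\<gamma>. \<alpha> \<turnstile> \<gamma> \<in> KL} \<in> ?A"
    using assms KL.refl by blast
  then have nonempty: "?A \<noteq> {}" by blast
  have chain: "\<Union>C \<in> ?A" if "C \<noteq> {}" "subset.chain ?A C" for C
  proof -
    have C: "theory_KL T" "\<alpha> \<in> T" "\<beta> \<notin> T" if "T \<in> C" for T
      using that \<open>subset.chain ?A C\<close> by (auto simp: subset_chain_def)
    have "theory_KL (\<Union>C)"
      unfolding theory_KL_def
    proof (intro HOL.conjI ballI allI impI)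
      fix \<gamma> \<delta>
      assume "\<gamma> \<in> \<Union>C" "\<gamma> \<turnstile> \<delta> \<in> KL"
      then show "\<delta> \<in> \<Union>C" using C(1) theory_KL_closed by blast
    next
      fix \<gamma> \<delta>
      assume "\<gamma> \<in> \<Union>C" "\<delta> \<in> \<Union>C"
      then obtain S T where ST: "S \<in> C" "T \<in> C" "\<gamma> \<in> S" "\<delta> \<in> T"
        by blast
      \<comment> \<open>Comparability in the chain places both formulas in the larger of the two
        theories.\<close>
      then have "S \<subseteq> T \<or> T \<subseteq> S"
        using \<open>subset.chain ?A C\<close> by (auto simp: subset_chain_def)
      then have "\<gamma> \<^bold>\<and> \<delta> \<in> S \<or> \<gamma> \<^bold>\<and> \<delta> \<in> T"
        using ST by (auto simp: theory_KL_conj C(1))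
      then show "\<gamma> \<^bold>\<and> \<delta> \<in> \<Union>C" using ST by blast
    qed
    then show ?thesis using C \<open>C \<noteq> {}\<close> by blast
  qed
  obtain T where T: "T \<in> ?A" and max: "\<forall>S\<in>?A. T \<subseteq> S \<longrightarrow> S = T"
    using subset_Zorn_nonempty[OF nonempty chain] by blast
  have "prime_theory T"
    by (rule maximal_theory_prime[of T \<beta>]) (use T max in auto)
  then show thesis using T that by blast
qed

section \<open>Connectives in prime theories\<close>

lemma prime_theory_disj: "prime_theory T \<Longrightarrow> \<gamma> \<^bold>\<or> \<delta> \<in> T \<longleftrightarrow> \<gamma> \<in> T \<or> \<delta> \<in> T"
  unfolding prime_theory_def theory_KL_def using KL.disjI1 KL.disjI2 by blast

lemma prime_theory_conj: "prime_theory T \<Longrightarrow> \<gamma> \<^bold>\<and> \<delta> \<in> T \<longleftrightarrow> \<gamma> \<in> T \<and> \<delta> \<in> T"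
  by (simp add: prime_theory_def theory_KL_conj)

lemma prime_theory_closed: "\<lbrakk>prime_theory T; \<gamma> \<in> T; \<gamma> \<turnstile> \<delta> \<in> KL\<rbrakk> \<Longrightarrow> \<delta> \<in> T"
  unfolding prime_theory_def using theory_KL_closed by blast

lemma prime_theory_dneg: "prime_theory T \<Longrightarrow> \<^bold>\<not> \<^bold>\<not> \<gamma> \<in> T \<longleftrightarrow> \<gamma> \<in> T"
  using prime_theory_closed KL.dnegI KL.dnegE by blast

text \<open>The axioms give each de Morgan law in one direction only. Contraposing the projections,
  and the injections in the next lemma, supplies the other, so that membership of negated compounds
  becomes an equivalence.\<close>

lemma KL_de_Morgan_conj: "\<^bold>\<not> \<gamma> \<^bold>\<or> \<^bold>\<not> \<delta> \<turnstile> \<^bold>\<not> (\<gamma> \<^bold>\<and> \<delta>) \<in> KL"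
  by (intro KL.disjE KL.contrapos KL.conjE1 KL.conjE2)

lemma KL_de_Morgan_disj: "\<^bold>\<not> (\<gamma> \<^bold>\<or> \<delta>) \<turnstile> \<^bold>\<not> \<gamma> \<^bold>\<and> \<^bold>\<not> \<delta> \<in> KL"
  by (intro KL.conjI KL.contrapos KL.disjI1 KL.disjI2)

lemma prime_theory_neg_conj:
  "prime_theory T \<Longrightarrow> \<^bold>\<not> (\<gamma> \<^bold>\<and> \<delta>) \<in> T \<longleftrightarrow> \<^bold>\<not> \<gamma> \<in> T \<or> \<^bold>\<not> \<delta> \<in> T"
  using prime_theory_closed prime_theory_disj KL.neg_conj KL_de_Morgan_conj by metis

lemma prime_theory_neg_disj:
  "prime_theory T \<Longrightarrow> \<^bold>\<not> (\<gamma> \<^bold>\<or> \<delta>) \<in> T \<longleftrightarrow> \<^bold>\<not> \<gamma> \<in> T \<and> \<^bold>\<not> \<delta> \<in> T"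
  using prime_theory_closed prime_theory_conj KL.neg_disj KL_de_Morgan_disj by metis

text \<open>The left inclusion means that \<open>T\<close> contains no formula together with its
  negation, the right one that it contains every formula or its negation. The Kalman axiom excludes
  failure of both: one contradiction in \<open>T\<close> would put every excluded middle into
  \<open>T\<close>.\<close>

lemma prime_theory_dual_comparable:
  assumes "prime_theory T"
  shows "T \<subseteq> {\<gamma>. \<^bold>\<not> \<gamma> \<notin> T} \<or> {\<gamma>. \<^bold>\<not> \<gamma> \<notin> T} \<subseteq> T"
proof (rule disjCI, rule subsetI)
  fix \<gamma>
  assume "\<not> {\<gamma>. \<^bold>\<not> \<gamma> \<notin> T} \<subseteq> T" "\<gamma> \<in> T"
  then obtain \<delta> where "\<delta> \<^bold>\<or> \<^bold>\<not> \<delta> \<notin> T"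
    using assms prime_theory_disj by blast
  then have "\<gamma> \<^bold>\<and> \<^bold>\<not> \<gamma> \<notin> T"
    using assms prime_theory_closed KL.kalman by blast
  then show "\<gamma> \<in> {\<gamma>. \<^bold>\<not> \<gamma> \<notin> T}"
    using assms \<open>\<gamma> \<in> T\<close> prime_theory_conj by blast
qed

section \<open>The four-element chain\<close>

lemma routley_IM_I_KL:
  "routley_IM I_KL V \<longleftrightarrow> (\<forall>p. proper_filter I_KL (V p))"
  using I_KL_in_inv_lin_IFs by (simp add: routley_IM_def inv_lin_IFs_def)

text \<open>\<open>A\<close> and \<open>B\<close> are the intended theories of \<open>St_t\<close>
  and \<open>St_s\<close>. With \<open>A \<subseteq> B\<close> the sets are upward closed;
  \<open>St_i\<close> is in and \<open>St_e\<close> out, as for any proper filter.\<close>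

definition chain_val :: "'a fm set \<Rightarrow> 'a fm set \<Rightarrow> 'a \<Rightarrow> state4 set" where
  "chain_val A B p =
     {St_i} \<union> (if Atom p \<in> B then {St_s} else {}) \<union> (if Atom p \<in> A then {St_t} else {})"

lemma chain_val_model:
  assumes "A \<subseteq> B"
  shows "routley_IM I_KL (chain_val A B)"
proof -
  have "Atom p \<in> A \<Longrightarrow> Atom p \<in> B" for p
    using assms by blast
  moreover have "(\<forall>x. P x) \<longleftrightarrow> P St_e \<and> P St_t \<and> P St_s \<and> P St_i" for P
    by (metis state4.exhaust)
  ultimately show ?thesis
    unfolding routley_IM_I_KL proper_filter_def by (simp add: chain_val_def I_KL_def)
qed

text \<open>The assumptions \<open>neg\<close> make \<open>A\<close> and \<open>B\<close> duals of
  each other, matching the exchange of \<open>St_t\<close> and \<open>St_s\<close> by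
  \<open>star4\<close>. A negation thus moves between the two states, which is why they share one
  induction.\<close>

lemma chain_val_truth:
  assumes "A \<subseteq> B"
    and conj: "\<And>\<gamma> \<delta> X. X \<in> {A, B} \<Longrightarrow> \<gamma> \<^bold>\<and> \<delta> \<in> X \<longleftrightarrow> \<gamma> \<in> X \<and> \<delta> \<in> X"
    and disj: "\<And>\<gamma> \<delta> X. X \<in> {A, B} \<Longrightarrow> \<gamma> \<^bold>\<or> \<delta> \<in> X \<longleftrightarrow> \<gamma> \<in> X \<or> \<delta> \<in> X"
    and neg: "\<And>\<gamma>. \<^bold>\<not> \<gamma> \<in> A \<longleftrightarrow> \<gamma> \<notin> B" "\<And>\<gamma>. \<^bold>\<not> \<gamma> \<in> B \<longleftrightarrow> \<gamma> \<notin> A"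
  shows "(supports I_KL (chain_val A B) St_t \<gamma> \<longleftrightarrow> \<gamma> \<in> A) \<and>
         (supports I_KL (chain_val A B) St_s \<gamma> \<longleftrightarrow> \<gamma> \<in> B)"
proof -
  interpret linear_involutive_model I_KL "chain_val A B"
    using I_KL_in_inv_lin_IFs chain_val_model[OF \<open>A \<subseteq> B\<close>]
    by unfold_locales (simp_all add: inv_lin_IFs_def)
  have I_KL: "s \<in> states I_KL" "star I_KL s = star4 s" for s
    by (simp_all add: I_KL_def)
  show ?thesis
  proof (induction \<gamma>)
    case (Atom p)
    then show ?case by (simp add: chain_val_def)
  qed (simp_all add: I_KL conj disj neg supports_disj del: supports.simps(3))
qed

lemma KL_complete_I_KL:
  assumes "valid I_KL \<alpha> \<beta>"
  shows "\<alpha> \<turnstile> \<beta> \<in> KL"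
proof (rule ccontr)
  assume "\<alpha> \<turnstile> \<beta> \<notin> KL"
  then obtain T where T: "prime_theory T" "\<alpha> \<in> T" "\<beta> \<notin> T"
    by (rule prime_theory_exists)
  define D where "D = {\<gamma>. \<^bold>\<not> \<gamma> \<notin> T}"
  \<comment> \<open>These facts discharge the assumptions of \<open>chain_val_truth\<close>:
    \<open>D\<close> respects \<and> and \<or> by the de Morgan laws, and double negation makes
    \<open>T\<close> the dual of \<open>D\<close>.\<close>
  note closure = D_def T(1) prime_theory_conj prime_theory_disj prime_theory_dneg
    prime_theory_neg_conj prime_theory_neg_disj
  have valid: "supports I_KL V s \<alpha> \<Longrightarrow> supports I_KL V s \<beta>" if "routley_IM I_KL V" for V s
    using assms that by (auto simp: valid_def I_KL_def)
  \<comment> \<open>The smaller theory must sit at the lower state, so \<open>T\<close> is placed at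
    \<open>St_t\<close> or at \<open>St_s\<close> accordingly. Either way that state supports
    \<alpha> but not \<beta>.\<close>
  consider "T \<subseteq> D" | "D \<subseteq> T"
    using prime_theory_dual_comparable[OF T(1)] by (auto simp: D_def)
  then show False
  proof cases
    case 1
    have "supports I_KL (chain_val T D) St_t \<gamma> \<longleftrightarrow> \<gamma> \<in> T" for \<gamma>
      by (rule conjunct1, rule chain_val_truth) (use 1 in \<open>auto simp: closure\<close>)
    then show False using valid[OF chain_val_model[OF 1]] T by blast
  next
    case 2
    have "supports I_KL (chain_val D T) St_s \<gamma> \<longleftrightarrow> \<gamma> \<in> T" for \<gamma>
      by (rule conjunct2, rule chain_val_truth) (use 2 in \<open>auto simp: closure\<close>)
    then show False using valid[OF chain_val_model[OF 2]] T by blast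
  qed
qed

section \<open>Isomorphic copies of frames\<close>

text \<open>Arguments are pulled back along \<open>inv f\<close>. Outside the range of
  \<open>f\<close> this yields arbitrary values, but the new carrier lies inside that range.\<close>

definition map_frame :: "('s \<Rightarrow> 't) \<Rightarrow> 's routley \<Rightarrow> 't routley" where
  "map_frame f F = \<lparr>states = f ` states F, comp = (\<lambda>x y. f (comp F (inv f x) (inv f y))),
     star = (\<lambda>x. f (star F (inv f x))), istate = f (istate F), estate = f (estate F)\<rparr>"

text \<open>Unfolds the order on a set of pairs into quantifiers bounded by the carrier, the form in
  which it transfers along an injection by rewriting alone.\<close>

lemma linearly_ordered_iff:
  "linearly_ordered F \<longleftrightarrow>
     (\<forall>s\<in>states F. le F s s) \<and>
     (\<forall>s\<in>states F. \<forall>t\<in>states F. \<forall>u\<in>states F. le F s t \<longrightarrow> le F t u \<longrightarrow> le F s u) \<and>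
     (\<forall>s\<in>states F. \<forall>t\<in>states F. le F s t \<longrightarrow> le F t s \<longrightarrow> s = t) \<and>
     (\<forall>s\<in>states F. \<forall>t\<in>states F. s \<noteq> t \<longrightarrow> le F s t \<or> le F t s)"
proof -
  let ?R = "{(s, t). s \<in> states F \<and> t \<in> states F \<and> le F s t}"
  have "refl_on (states F) ?R \<longleftrightarrow> (\<forall>s\<in>states F. le F s s)"
    by (auto simp: refl_on_def)
  moreover have "?R \<subseteq> states F \<times> states F"
    by auto
  moreover have "trans ?R \<longleftrightarrow>
      (\<forall>s\<in>states F. \<forall>t\<in>states F. \<forall>u\<in>states F. le F s t \<longrightarrow> le F t u \<longrightarrow> le F s u)"
    unfolding trans_def by simp blast
  moreover have "antisym ?R \<longleftrightarrow>
      (\<forall>s\<in>states F. \<forall>t\<in>states F. le F s t \<longrightarrow> le F t s \<longrightarrow> s = t)"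
    unfolding antisym_def by simp blast
  moreover have "total_on (states F) ?R \<longleftrightarrow>
      (\<forall>s\<in>states F. \<forall>t\<in>states F. s \<noteq> t \<longrightarrow> le F s t \<or> le F t s)"
    by (simp add: total_on_def)
  ultimately show ?thesis
    by (simp add: linearly_ordered_def linear_order_on_def partial_order_on_def preorder_on_def)
qed

context
  fixes f :: "'s \<Rightarrow> 't"
  assumes inj: "inj f"
begin

lemma map_frame_simps:
  "states (map_frame f F) = f ` states F"
  "comp (map_frame f F) (f s) (f t) = f (comp F s t)"
  "star (map_frame f F) (f s) = f (star F s)"
  "istate (map_frame f F) = f (istate F)"
  "estate (map_frame f F) = f (estate F)"
  "le (map_frame f F) (f s) (f t) \<longleftrightarrow> le F s t"
  by (simp_all add: map_frame_def le_def inj inj_eq)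

lemma map_frame_routley_IF: "routley_IF F \<Longrightarrow> routley_IF (map_frame f F)"
  unfolding routley_IF_def
  \<comment> \<open>Quantifiers over the image become quantifiers over \<open>states F\<close>, and
    injectivity cancels \<open>f\<close>. The goals that remain are the axioms of \<open>F\<close>
    verbatim.\<close>
  by (simp only: map_frame_simps ball_simps inj_eq[OF inj] inj_image_mem_iff[OF inj] simp_thms)
    (elim conjE, intro HOL.conjI; assumption)

lemma map_frame_involutive: "involutive F \<Longrightarrow> involutive (map_frame f F)"
  unfolding involutive_def by (simp add: map_frame_simps)

lemma map_frame_linearly_ordered: "linearly_ordered F \<Longrightarrow> linearly_ordered (map_frame f F)"
  by (simp only: linearly_ordered_iff map_frame_simps ball_simps inj_eq[OF inj] simp_thms)

lemma map_frame_inv_lin_IFs: "F \<in> inv_lin_IFs \<Longrightarrow> map_frame f F \<in> inv_lin_IFs"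
  by (simp add: inv_lin_IFs_def map_frame_routley_IF map_frame_involutive
      map_frame_linearly_ordered)

lemma map_frame_routley_IM: "routley_IM F V \<Longrightarrow> routley_IM (map_frame f F) (\<lambda>p. f ` V p)"
  unfolding routley_IM_def proper_filter_def
  by (simp add: map_frame_simps map_frame_routley_IF inj inj_image_mem_iff image_mono)

lemma map_frame_supports:
  "supports (map_frame f F) (\<lambda>p. f ` V p) (f s) \<alpha> \<longleftrightarrow> supports F V s \<alpha>"
  by (induction \<alpha> arbitrary: s) (simp_all add: map_frame_simps inj inj_image_mem_iff)

text \<open>A countermodel on \<open>F\<close> is carried by \<open>f\<close> to a countermodel on
  the copy.\<close>

lemma valid_map_frameD:
  assumes "valid (map_frame f F) \<alpha> \<beta>"
  shows "valid F \<alpha> \<beta>"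
  unfolding valid_def
proof (intro allI impI ballI)
  fix V s
  assume "routley_IM F V" "s \<in> states F" "supports F V s \<alpha>"
  then have "routley_IM (map_frame f F) (\<lambda>p. f ` V p)" "f s \<in> states (map_frame f F)"
      "supports (map_frame f F) (\<lambda>p. f ` V p) (f s) \<alpha>"
    by (simp_all add: map_frame_routley_IM map_frame_simps map_frame_supports)
  then have "supports (map_frame f F) (\<lambda>p. f ` V p) (f s) \<beta>"
    using assms unfolding valid_def by blast
  then show "supports F V s \<beta>"
    by (simp add: map_frame_supports)
qed

end

section \<open>Completeness over an infinite state type\<close>

lemma inj_state4_exists:
  assumes "infinite (UNIV :: 's set)"
  obtains f :: "state4 \<Rightarrow> 's" where "inj f"
proof -
  obtain g :: "nat \<Rightarrow> 's" where "inj g"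
    using assms infinite_countable_subset by blast
  moreover have "inj rank4"
  proof (rule injI)
    show "x = y" if "rank4 x = rank4 y" for x y
      using that by (cases x; cases y) simp_all
  qed
  ultimately show thesis
    using that inj_compose by blast
qed

text \<open>The class over \<open>'s\<close> contains a copy of \<open>I_KL\<close>, so validity in
  the class passes through this copy to \<open>I_KL\<close>.\<close>

lemma KL_complete_inv_lin_IFs:
  assumes "infinite (UNIV :: 's set)" and "valid_in_class (inv_lin_IFs :: 's routley set) \<alpha> \<beta>"
  shows "\<alpha> \<turnstile> \<beta> \<in> KL"
proof -
  obtain f :: "state4 \<Rightarrow> 's" where f: "inj f"
    using assms(1) by (rule inj_state4_exists)
  have "valid (map_frame f I_KL) \<alpha> \<beta>"
    using assms(2) map_frame_inv_lin_IFs[OF f I_KL_in_inv_lin_IFs] by (simp add: valid_in_class_def)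
  then show ?thesis
    using valid_map_frameD[OF f] KL_complete_I_KL by blast
qed

text \<open>The class depends on its state type, and types cannot be quantified over inside a
  formula. Hence \<open>'s\<close> is taken large enough to carry countermodels, while the middle
  conjunct records soundness over an arbitrary state type \<open>'t\<close>, finite ones
  included.\<close>

theorem theorem2:
  assumes "infinite (UNIV :: 's set)"
  shows
    "(\<forall>\<alpha> \<beta> :: 'a fm. valid_in_class (inv_lin_IFs :: 's routley set) \<alpha> \<beta> \<longleftrightarrow> \<alpha> \<turnstile> \<beta> \<in> KL) \<and>
     (\<forall>\<alpha> \<beta> :: 'a fm. \<alpha> \<turnstile> \<beta> \<in> KL \<longrightarrow> valid_in_class (inv_lin_IFs :: 't routley set) \<alpha> \<beta>) \<and>
     (KL :: ('a fm \<times> 'a fm) set) = {\<alpha> \<turnstile> \<beta> | \<alpha> \<beta>. valid I_KL \<alpha> \<beta>}"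
proof (intro HOL.conjI allI impI)
  show "valid_in_class (inv_lin_IFs :: 's routley set) \<alpha> \<beta> \<longleftrightarrow> \<alpha> \<turnstile> \<beta> \<in> KL" for \<alpha> \<beta> :: "'a fm"
    using KL_sound KL_complete_inv_lin_IFs[OF assms] by blast
  show "valid_in_class (inv_lin_IFs :: 't routley set) \<alpha> \<beta>" if "\<alpha> \<turnstile> \<beta> \<in> KL" for \<alpha> \<beta> :: "'a fm"
    using that by (rule KL_sound)
  have "\<alpha> \<turnstile> \<beta> \<in> KL \<longleftrightarrow> valid I_KL \<alpha> \<beta>" for \<alpha> \<beta> :: "'a fm"
    using KL_sound KL_complete_I_KL I_KL_in_inv_lin_IFs unfolding valid_in_class_def by blast
  then show "(KL :: ('a fm \<times> 'a fm) set) = {\<alpha> \<turnstile> \<beta> | \<alpha> \<beta>. valid I_KL \<alpha> \<beta>}"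
    by auto
qed

end
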